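(* Let $m\ge1$ and $x_1,\dots,x_{2m}\in H$. For $q=0$, with $G_0(x)=d_0(x)+d_0^\ast(x)$, $$\langle\Omega,G_0(x_1)\cdots G_0(x_{2m})\Omega\rangle_0=\sum_{\pi\in\mathcal{NC}_2(2m)}\prod_{\{i<j\}\in\pi}\langle x_i,x_j\rangle ,$$ where $\mathcal{NC}_2(2m)$ is the set of noncrossing pair partitions of $\{1,\dots,2m\}$.
   Context: Fock space. $H$ is a complex Hilbert space with inner product $\langle\cdot,\cdot\rangle$ linear in the right argument and antilinear in the left one; $x\mapsto\overline{x}$ is a fixed selfadjoint involution on $H$, i.e. a bounded selfadjoint linear operator whose square is the identity. Let $B(n)$ be the group of permutations $\sigma$ of $\{\pm1,\dots,\pm n\}$ with $\sigma(-k)=-\sigma(k)$; put $\pi_i=(i,i+1)(-i,-i-1)$ for $1\le i\le n-1$, $\overline{\pi}_n=(n,-n)$ and $\widehat{\pi}_{n-1}=\overline{\pi}_n\pi_{n-1}\overline{\pi}_n$. The Coxeter group $D(n)$ of type D is $D(1)=\{e\}$ and, for $n\ge2$, the subgroup of $B(n)$ generated by $\pi_1,\dots,\pi_{n-1},\widehat{\pi}_{n-1}$; $\ell(\sigma)$ is the minimal number of these generators in a product expression of $\sigma\in D(n)$. For $n\ge 2$, $D(n)$ acts on $H^{\otimes n}$ by $\pi_i(x_1\otimes\cdots\otimes x_n)=x_1\otimes\cdots\otimes x_{i-1}\otimes x_{i+1}\otimes x_i\otimes x_{i+2}\otimes\cdots\otimes x_n$ and $\widehat{\pi}_{n-1}(x_1\otimes\cdots\otimes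 x_n)=x_1\otimes\cdots\otimes x_{n-2}\otimes\overline{x}_n\otimes\overline{x}_{n-1}$; $D(1)$ acts trivially on $H$. Put $\widehat{P}_q^{(n)}=\sum_{\sigma\in D(n)}q^{\ell(\sigma)}\sigma$ for $n\ge1$ and $\widehat P_q^{(0)}=I$ (convention $0^0=1$, so $\widehat P_0^{(n)}=I$). Let $\mathcal{F}_{\rm fin}(H)=\bigoplus_{n\ge0}H^{\otimes n}$ be the algebraic direct sum, $H^{\otimes0}=\mathbb{C}\Omega$ with $\Omega$ a unit vector, with the usual inner product $\langle x_1\otimes\cdots\otimes x_m,y_1\otimes\cdots\otimes y_n\rangle_0=\delta_{m,n}\prod_i\langle x_i,y_i\rangle$, and $\widehat P_q=\bigoplus_n\widehat P_q^{(n)}$. For $q\in(-1,1)$, $\langle f,g\rangle_q:=\langle f,\widehat P_q g\rangle_0$ is an inner product. The creation operator is $d_q^\ast(x)(x_1\otimes\cdots\otimes x_n)=x\otimes x_1\otimes\cdots\otimes x_n$, $d_q^\ast(x)\Omega=x$, and $d_q(x)$ is its adjoint with respect to $\langle\cdot,\cdot\rangle_q$. A pair partition is noncrossing if it has no two pairs $\{a<b\},\{c<d\}$ with $a<c<b<d$. *)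

theory Defs
  imports
    Complex_Main
    "HOL-Library.Poly_Mapping"
    "HOL-Library.Disjoint_Sets"
    "HOL-Combinatorics.Permutations"
    "HOL-Algebra.Generated_Groups"
begin

section \<open>Complex Hilbert spaces\<close>

class scaleC =
  fixes scaleC :: "complex \<Rightarrow> 'a \<Rightarrow> 'a"  (infixr \<open>*\<^sub>C\<close> 75)

class complex_vector = scaleC + ab_group_add +
  assumes scaleC_add_right: "a *\<^sub>C (x + y) = a *\<^sub>C x + a *\<^sub>C y"
    and scaleC_add_left: "(a + b) *\<^sub>C x = a *\<^sub>C x + b *\<^sub>C x"
    and scaleC_scaleC: "a *\<^sub>C b *\<^sub>C x = (a * b) *\<^sub>C x"
    and scaleC_one: "1 *\<^sub>C x = x"

global_interpretation complex_vector: vector_space "scaleC :: complex \<Rightarrow> 'a \<Rightarrow> 'a::complex_vector"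
  by unfold_locales
    (simp_all add: scaleC_add_right scaleC_add_left scaleC_scaleC scaleC_one)

text \<open>The inner product is linear in the right argument; completeness comes from \<open>banach\<close>.\<close>

class chilbert_space = complex_vector + banach +
  fixes cinner :: "'a \<Rightarrow> 'a \<Rightarrow> complex"
  assumes scaleR_scaleC: "r *\<^sub>R x = complex_of_real r *\<^sub>C x"
    and cinner_add_right: "cinner x (y + z) = cinner x y + cinner x z"
    and cinner_scaleC_right: "cinner x (c *\<^sub>C y) = c * cinner x y"
    and cinner_commute: "cinner x y = cnj (cinner y x)"
    and cinner_ge_zero: "0 \<le> Re (cinner x x)"
    and cinner_eq_zero_iff: "cinner x x = 0 \<longleftrightarrow> x = 0"
    and norm_eq_sqrt_cinner: "norm x = sqrt (Re (cinner x x))"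

instantiation complex :: chilbert_space
begin

definition scaleC_complex :: "complex \<Rightarrow> complex \<Rightarrow> complex" where
  [simp]: "scaleC_complex c x = c * x"

definition cinner_complex :: "complex \<Rightarrow> complex \<Rightarrow> complex" where
  "cinner_complex x y = cnj x * y"

instance
  by standard
    (auto simp: cinner_complex_def algebra_simps scaleR_conv_of_real cmod_def power2_eq_square)

end

definition selfadjoint_involution :: "('h::chilbert_space \<Rightarrow> 'h) \<Rightarrow> bool" where
  "selfadjoint_involution J \<longleftrightarrow>
     bounded_linear J \<and> (\<forall>c x. J (c *\<^sub>C x) = c *\<^sub>C J x) \<and>
     (\<forall>x y. cinner (J x) y = cinner x (J y)) \<and> (\<forall>x. J (J x) = x)"


section \<open>The algebraic Fock space\<close>

instantiation poly_mapping :: (type, complex_vector) complex_vector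
begin

definition scaleC_poly_mapping :: "complex \<Rightarrow> ('a \<Rightarrow>\<^sub>0 'b) \<Rightarrow> 'a \<Rightarrow>\<^sub>0 'b" where
  "scaleC_poly_mapping c f = Poly_Mapping.map (scaleC c) f"

lemma lookup_scaleC: "Poly_Mapping.lookup (c *\<^sub>C f) k = c *\<^sub>C Poly_Mapping.lookup (f :: 'a \<Rightarrow>\<^sub>0 'b) k"
  by (simp add: scaleC_poly_mapping_def Poly_Mapping.map.rep_eq when_def complex_vector.scale_zero_right)

instance
  by standard
    (auto intro!: poly_mapping_eqI simp: lookup_scaleC lookup_add
      scaleC_add_right scaleC_add_left scaleC_scaleC scaleC_one)

end

text \<open>
  The direct sum of all algebraic tensor powers of \<open>H\<close> is the free vector space on the lists
  of vectors (the list \<open>[x\<^sub>1, \<dots>, x\<^sub>n]\<close> standing for \<open>x\<^sub>1 \<otimes> \<dots> \<otimes> x\<^sub>n\<close>, the empty list for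
  \<open>\<Omega>\<close>) modulo the relations of multilinearity.
\<close>

definition tensor_relators :: "('h::complex_vector list \<Rightarrow>\<^sub>0 complex) set" where
  "tensor_relators =
     {Poly_Mapping.single (xs[i := u + v]) 1 - Poly_Mapping.single (xs[i := u]) 1
        - Poly_Mapping.single (xs[i := v]) 1 | xs i u v. i < length xs} \<union>
     {Poly_Mapping.single (xs[i := c *\<^sub>C u]) 1 - c *\<^sub>C Poly_Mapping.single (xs[i := u]) 1
        | xs i c u. i < length xs}"

definition tensor_eq ::
    "('h::complex_vector list \<Rightarrow>\<^sub>0 complex) \<Rightarrow> ('h list \<Rightarrow>\<^sub>0 complex) \<Rightarrow> bool" where
  "tensor_eq f g \<longleftrightarrow> f - g \<in> complex_vector.span tensor_relators"

lemma equivp_tensor_eq: "equivp tensor_eq"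
proof (rule equivpI)
  show "reflp tensor_eq"
    by (auto simp: reflp_def tensor_eq_def complex_vector.span_zero)
  show "symp tensor_eq"
    by (auto simp: symp_def tensor_eq_def dest: complex_vector.span_neg)
  show "transp tensor_eq"
    by (auto simp: transp_def tensor_eq_def dest: complex_vector.span_add)
qed

quotient_type (overloaded) 'h fock = "'h::complex_vector list \<Rightarrow>\<^sub>0 complex" / tensor_eq
  by (rule equivp_tensor_eq)

instantiation fock :: (complex_vector) complex_vector
begin

lift_definition zero_fock :: "'a fock" is 0 .

lift_definition plus_fock :: "'a fock \<Rightarrow> 'a fock \<Rightarrow> 'a fock" is "(+)"
  unfolding tensor_eq_def by (drule (1) complex_vector.span_add) (simp add: algebra_simps)

lift_definition minus_fock :: "'a fock \<Rightarrow> 'a fock \<Rightarrow> 'a fock" is "(-)"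
  unfolding tensor_eq_def by (drule (1) complex_vector.span_diff) (simp add: algebra_simps)

lift_definition uminus_fock :: "'a fock \<Rightarrow> 'a fock" is uminus
  unfolding tensor_eq_def by (drule complex_vector.span_neg) simp

lift_definition scaleC_fock :: "complex \<Rightarrow> 'a fock \<Rightarrow> 'a fock" is scaleC
  unfolding tensor_eq_def
  by (metis complex_vector.span_scale complex_vector.scale_right_diff_distrib)

lemma tensor_eq_refl [simp]: "tensor_eq f f"
  by (simp add: tensor_eq_def complex_vector.span_zero)

instance
  by standard
    (transfer; simp add: algebra_simps scaleC_add_right scaleC_add_left scaleC_scaleC scaleC_one)+

end

lift_definition tens :: "'h::complex_vector list \<Rightarrow> 'h fock" is "\<lambda>xs. Poly_Mapping.single xs 1" .

abbreviation vacuum :: "'h::complex_vector fock" (\<open>\<Omega>\<close>) where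
  "\<Omega> \<equiv> tens []"

definition multilinear :: "('h::complex_vector list \<Rightarrow> 'v::complex_vector) \<Rightarrow> bool" where
  "multilinear \<phi> \<longleftrightarrow>
     (\<forall>xs i u v. i < length xs \<longrightarrow> \<phi> (xs[i := u + v]) = \<phi> (xs[i := u]) + \<phi> (xs[i := v])) \<and>
     (\<forall>xs i c u. i < length xs \<longrightarrow> \<phi> (xs[i := c *\<^sub>C u]) = c *\<^sub>C \<phi> (xs[i := u]))"

lemma multilinear_add:
  "multilinear \<phi> \<Longrightarrow> i < length xs \<Longrightarrow> \<phi> (xs[i := u + v]) = \<phi> (xs[i := u]) + \<phi> (xs[i := v])"
  by (simp add: multilinear_def)

lemma multilinear_scaleC:
  "multilinear \<phi> \<Longrightarrow> i < length xs \<Longrightarrow> \<phi> (xs[i := c *\<^sub>C u]) = c *\<^sub>C \<phi> (xs[i := u])"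
  by (simp add: multilinear_def)

text \<open>
  The linear map with \<open>tens xs \<mapsto> \<phi> xs\<close>. It is evaluated on a representative and is
  meaningful for multilinear \<open>\<phi>\<close> only; see \<open>fock_lift_tens\<close>, \<open>fock_lift_add\<close> and
  \<open>fock_lift_scaleC\<close>.
\<close>

definition free_lift ::
    "('h list \<Rightarrow> 'v::complex_vector) \<Rightarrow> ('h list \<Rightarrow>\<^sub>0 complex) \<Rightarrow> 'v" where
  "free_lift \<phi> f = (\<Sum>xs\<in>Poly_Mapping.keys f. Poly_Mapping.lookup f xs *\<^sub>C \<phi> xs)"

definition fock_lift ::
    "('h::complex_vector list \<Rightarrow> 'v::complex_vector) \<Rightarrow> 'h fock \<Rightarrow> 'v" where
  "fock_lift \<phi> t = free_lift \<phi> (rep_fock t)"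

lemma free_lift_superset:
  assumes "finite A" "Poly_Mapping.keys f \<subseteq> A"
  shows "free_lift \<phi> f = (\<Sum>xs\<in>A. Poly_Mapping.lookup f xs *\<^sub>C \<phi> xs)"
  unfolding free_lift_def
  by (rule sum.mono_neutral_left) (use assms in \<open>auto simp: in_keys_iff\<close>)

lemma free_lift_single [simp]: "free_lift \<phi> (Poly_Mapping.single xs c) = c *\<^sub>C \<phi> xs"
  by (cases "c = 0") (simp_all add: free_lift_def)

lemma free_lift_add: "free_lift \<phi> (f + g) = free_lift \<phi> f + free_lift \<phi> g"
proof -
  let ?A = "Poly_Mapping.keys f \<union> Poly_Mapping.keys g"
  have "Poly_Mapping.keys (f + g) \<subseteq> ?A"
    by (rule keys_add)
  then show ?thesis
    by (simp add: free_lift_superset[of ?A] lookup_add scaleC_add_left sum.distrib)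
qed

lemma free_lift_scaleC: "free_lift \<phi> (c *\<^sub>C f) = c *\<^sub>C free_lift \<phi> f"
proof -
  have "Poly_Mapping.keys (c *\<^sub>C f) \<subseteq> Poly_Mapping.keys f"
    by (auto simp: in_keys_iff lookup_scaleC)
  then show ?thesis
    by (simp add: free_lift_superset[of "Poly_Mapping.keys f"] lookup_scaleC scaleC_scaleC
        complex_vector.scale_sum_right)
qed

lemma free_lift_diff: "free_lift \<phi> (f - g) = free_lift \<phi> f - free_lift \<phi> g"
  using free_lift_add[of \<phi> "f - g" g] by (simp add: algebra_simps)

lemma free_lift_respects:
  assumes "multilinear \<phi>" "tensor_eq f g"
  shows "free_lift \<phi> f = free_lift \<phi> g"
proof -
  have "free_lift \<phi> h = 0" if "h \<in> complex_vector.span tensor_relators" for h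
    using that
  proof (induction rule: complex_vector.span_induct_alt)
    case base
    show ?case by (simp add: free_lift_def)
  next
    case (step c r h)
    have "free_lift \<phi> r = 0"
      using step(1) assms(1)
      by (auto simp: tensor_relators_def multilinear_def free_lift_diff free_lift_scaleC
          scaleC_one)
    then show ?case
      using step by (simp add: free_lift_add free_lift_scaleC)
  qed
  from this[of "f - g"] assms(2) show ?thesis
    by (simp add: tensor_eq_def free_lift_diff)
qed

lemma tensor_eq_rep_abs: "tensor_eq (rep_fock (abs_fock f)) f"
  by (rule Quotient3_rep_abs[OF Quotient3_fock]) simp

lemma fock_lift_abs: "multilinear \<phi> \<Longrightarrow> fock_lift \<phi> (abs_fock f) = free_lift \<phi> f"
  unfolding fock_lift_def by (rule free_lift_respects[OF _ tensor_eq_rep_abs])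

lemma abs_rep_fock: "abs_fock (rep_fock t) = t"
  by (rule Quotient3_abs_rep[OF Quotient3_fock])

lemma fock_lift_tens: "multilinear \<phi> \<Longrightarrow> fock_lift \<phi> (tens xs) = \<phi> xs"
  by (simp add: tens.abs_eq fock_lift_abs scaleC_one)

lemma fock_lift_add:
  assumes "multilinear \<phi>"
  shows "fock_lift \<phi> (s + t) = fock_lift \<phi> s + fock_lift \<phi> t"
  by (metis assms abs_rep_fock plus_fock.abs_eq fock_lift_abs free_lift_add)

lemma fock_lift_scaleC:
  assumes "multilinear \<phi>"
  shows "fock_lift \<phi> (c *\<^sub>C t) = c *\<^sub>C fock_lift \<phi> t"
  by (metis assms abs_rep_fock scaleC_fock.abs_eq fock_lift_abs free_lift_scaleC)


section \<open>The undeformed inner product and the creation operators\<close>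

definition tens_inner :: "'h::chilbert_space list \<Rightarrow> 'h list \<Rightarrow> complex" where
  "tens_inner xs ys =
     (if length xs = length ys then \<Prod>i<length xs. cinner (xs ! i) (ys ! i) else 0)"

text \<open>The sesquilinear extension of \<open>tens_inner\<close>, antilinear in the left argument.\<close>

definition fock_inner :: "'h::chilbert_space fock \<Rightarrow> 'h fock \<Rightarrow> complex" where
  "fock_inner f g = cnj (fock_lift (\<lambda>xs. cnj (fock_lift (tens_inner xs) g)) f)"

definition creation :: "'h::complex_vector \<Rightarrow> 'h fock \<Rightarrow> 'h fock" where
  "creation x = fock_lift (\<lambda>xs. tens (x # xs))"

lemma cinner_add_left: "cinner (x + y) z = cinner x z + cinner y (z :: 'h::chilbert_space)"
  by (simp add: cinner_commute[of _ z] cinner_add_right)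

lemma cinner_scaleC_left: "cinner (c *\<^sub>C x) y = cnj c * cinner x (y :: 'h::chilbert_space)"
  by (simp add: cinner_commute[of _ y] cinner_scaleC_right)

lemma tens_inner_split:
  assumes "i < length xs" "length ys = length xs"
  shows "tens_inner (xs[i := u]) (ys[i := v]) =
    cinner u v * (\<Prod>j\<in>{..<length xs} - {i}. cinner (xs ! j) (ys ! j))"
proof -
  have "tens_inner (xs[i := u]) (ys[i := v]) =
      (\<Prod>j\<in>{..<length xs}. cinner (xs[i := u] ! j) (ys[i := v] ! j))"
    using assms by (simp add: tens_inner_def)
  also have "\<dots> = cinner u v * (\<Prod>j\<in>{..<length xs} - {i}. cinner (xs[i := u] ! j) (ys[i := v] ! j))"
    using assms by (subst prod.remove[of _ i]) auto
  also have "(\<Prod>j\<in>{..<length xs} - {i}. cinner (xs[i := u] ! j) (ys[i := v] ! j)) =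
      (\<Prod>j\<in>{..<length xs} - {i}. cinner (xs ! j) (ys ! j))"
    by (rule prod.cong) auto
  finally show ?thesis .
qed

lemma multilinear_tens_inner_right: "multilinear (tens_inner xs)"
proof -
  have eq: "tens_inner xs (ys[i := v]) = (if length ys = length xs then
      cinner (xs ! i) v * (\<Prod>j\<in>{..<length xs} - {i}. cinner (xs ! j) (ys ! j)) else 0)"
    if "i < length ys" for ys i v
  proof (cases "length ys = length xs")
    case True
    with that have "i < length xs" by simp
    from tens_inner_split[OF this True, of "xs ! i" v] True show ?thesis
      by simp
  next
    case False
    then show ?thesis by (simp add: tens_inner_def)
  qed
  show ?thesis
    unfolding multilinear_def
    by (simp add: eq cinner_add_right cinner_scaleC_right ring_distribs)
qed

lemma tens_inner_commute: "tens_inner xs ys = cnj (tens_inner ys xs)"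
  by (auto simp: tens_inner_def simp flip: cinner_commute)

lemma cnj_fock_lift_tens_inner:
  "cnj (fock_lift (tens_inner xs) g) =
    (\<Sum>ys\<in>Poly_Mapping.keys (rep_fock g). cnj (Poly_Mapping.lookup (rep_fock g) ys) * tens_inner ys xs)"
  by (simp add: fock_lift_def free_lift_def flip: tens_inner_commute)

lemma multilinear_cnj_fock_lift_tens_inner:
  "multilinear (\<lambda>xs. cnj (fock_lift (tens_inner xs) g))"
  unfolding multilinear_def cnj_fock_lift_tens_inner
  by (auto simp: multilinear_add[OF multilinear_tens_inner_right]
      multilinear_scaleC[OF multilinear_tens_inner_right] ring_distribs sum.distrib
      sum_distrib_left mult_ac)

lemma fock_inner_tens: "fock_inner (tens xs) (tens ys) = tens_inner xs ys"
  unfolding fock_inner_def fock_lift_tens[OF multilinear_cnj_fock_lift_tens_inner]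
  by (simp add: fock_lift_tens[OF multilinear_tens_inner_right])

lemma fock_inner_add_left: "fock_inner (f + g) h = fock_inner f h + fock_inner g h"
  by (simp add: fock_inner_def fock_lift_add[OF multilinear_cnj_fock_lift_tens_inner])

lemma fock_inner_scaleC_left: "fock_inner (c *\<^sub>C f) g = cnj c * fock_inner f g"
  by (simp add: fock_inner_def fock_lift_scaleC[OF multilinear_cnj_fock_lift_tens_inner])

lemma fock_inner_alt:
  "fock_inner f g = (\<Sum>xs\<in>Poly_Mapping.keys (rep_fock f).
    cnj (Poly_Mapping.lookup (rep_fock f) xs) * fock_lift (tens_inner xs) g)"
  by (simp add: fock_inner_def fock_lift_def[of "\<lambda>xs. cnj (_ xs)"] free_lift_def)

lemma fock_inner_add_right: "fock_inner f (g + h) = fock_inner f g + fock_inner f h"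
  by (simp add: fock_inner_alt fock_lift_add[OF multilinear_tens_inner_right] ring_distribs
      sum.distrib)

lemma fock_inner_scaleC_right: "fock_inner f (c *\<^sub>C g) = c * fock_inner f g"
  by (simp add: fock_inner_alt fock_lift_scaleC[OF multilinear_tens_inner_right]
      sum_distrib_left mult_ac)

lemma multilinear_tens: "multilinear tens"
proof -
  have "tens (xs[i := u + v]) = tens (xs[i := u]) + tens (xs[i := v])"
    if "i < length xs" for xs :: "'a list" and i u v
    unfolding tens.abs_eq plus_fock.abs_eq fock.abs_eq_iff tensor_eq_def
    by (rule complex_vector.span_base, subst diff_diff_add[symmetric])
      (use that in \<open>unfold tensor_relators_def, blast\<close>)
  moreover have "tens (xs[i := c *\<^sub>C u]) = c *\<^sub>C tens (xs[i := u])"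
    if "i < length xs" for xs :: "'a list" and i c u
    unfolding tens.abs_eq scaleC_fock.abs_eq fock.abs_eq_iff tensor_eq_def
    by (rule complex_vector.span_base) (use that in \<open>unfold tensor_relators_def, blast\<close>)
  ultimately show ?thesis
    by (auto simp: multilinear_def)
qed

lemma multilinear_creation: "multilinear (\<lambda>xs. tens ((x :: 'a::complex_vector) # xs))"
  unfolding multilinear_def
proof (intro conjI allI impI)
  fix xs :: "'a list" and i u v assume "i < length xs"
  then show "tens (x # xs[i := u + v]) = tens (x # xs[i := u]) + tens (x # xs[i := v])"
    using multilinear_add[OF multilinear_tens, of "Suc i" "x # xs" u v] by simp
next
  fix xs :: "'a list" and i c u assume "i < length xs"
  then show "tens (x # xs[i := c *\<^sub>C u]) = c *\<^sub>C tens (x # xs[i := u])"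
    using multilinear_scaleC[OF multilinear_tens, of "Suc i" "x # xs" c u] by simp
qed

lemma creation_tens: "creation x (tens xs) = tens (x # xs)"
  by (simp add: creation_def fock_lift_tens multilinear_creation)


section \<open>Coxeter groups of type D\<close>

text \<open>Permutations of \<open>{\<plusminus>1, \<dots>, \<plusminus>n}\<close> are functions on \<open>int\<close> fixing all other points.\<close>

definition hyperoctahedral :: "nat \<Rightarrow> (int \<Rightarrow> int) monoid" where
  "hyperoctahedral n =
     \<lparr>carrier = {\<sigma>. \<sigma> permutes ({- int n..int n} - {0}) \<and> (\<forall>k. \<sigma> (- k) = - \<sigma> k)},
      mult = (\<circ>), one = id\<rparr>"

definition pi_gen :: "nat \<Rightarrow> int \<Rightarrow> int" where
  "pi_gen i = transpose (int i) (int i + 1) \<circ> transpose (- int i) (- int i - 1)"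

definition pi_bar :: "nat \<Rightarrow> int \<Rightarrow> int" where
  "pi_bar n = transpose (int n) (- int n)"

text \<open>\<open>pi_hat n\<close> is the generator with index \<open>n - 1\<close> of \<open>D(n)\<close>.\<close>

definition pi_hat :: "nat \<Rightarrow> int \<Rightarrow> int" where
  "pi_hat n = pi_bar n \<circ> pi_gen (n - 1) \<circ> pi_bar n"

lemma pi_gen_apply:
  assumes "i \<ge> 1"
  shows "pi_gen i k =
    (if k = int i then int i + 1 else if k = int i + 1 then int i
     else if k = - int i then - (int i + 1) else if k = - (int i + 1) then - int i else k)"
  using assms by (auto simp: pi_gen_def transpose_def)

lemma pi_hat_apply:
  assumes "n \<ge> 2"
  shows "pi_hat n k =
    (if k = int n - 1 then - int n else if k = int n then - (int n - 1)
     else if k = - (int n - 1) then int n else if k = - int n then int n - 1 else k)"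
proof -
  have "n - 1 \<ge> 1" "int (n - 1) = int n - 1" using assms by auto
  then show ?thesis
    using assms by (auto simp: pi_hat_def pi_bar_def transpose_def pi_gen_apply)
qed

definition D_gens :: "nat \<Rightarrow> (int \<Rightarrow> int) set" where
  "D_gens n = (if n < 2 then {} else insert (pi_hat n) (pi_gen ` {1..n - 1}))"

definition D_group :: "nat \<Rightarrow> (int \<Rightarrow> int) set" where
  "D_group n = generate (hyperoctahedral n) (D_gens n)"

lemma hyperoctahedral_inv_minus:
  assumes "\<sigma> \<in> carrier (hyperoctahedral n)"
  shows "inv_into UNIV \<sigma> (- k) = - inv_into UNIV \<sigma> k"
proof -
  have perm: "\<sigma> permutes ({- int n..int n} - {0})" and odd: "\<sigma> (- l) = - \<sigma> l" for l
    using assms by (auto simp: hyperoctahedral_def)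
  have "\<sigma> (- inv_into UNIV \<sigma> k) = - k"
    unfolding odd permutes_inverses(1)[OF perm] ..
  then show ?thesis
    by (simp only: permutes_inv_eq[OF perm])
qed

lemma group_hyperoctahedral: "group (hyperoctahedral n)"
proof (rule groupI)
  fix \<sigma> assume s: "\<sigma> \<in> carrier (hyperoctahedral n)"
  then show "\<exists>\<tau>\<in>carrier (hyperoctahedral n). \<tau> \<otimes>\<^bsub>hyperoctahedral n\<^esub> \<sigma> = \<one>\<^bsub>hyperoctahedral n\<^esub>"
    using hyperoctahedral_inv_minus[OF s] by (intro bexI[of _ "inv_into UNIV \<sigma>"])
      (auto simp: hyperoctahedral_def permutes_inv permutes_inv_o)
qed (auto simp: hyperoctahedral_def permutes_compose comp_assoc)

lemma pi_gen_carrier: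
  assumes "1 \<le> i" "i < n"
  shows "pi_gen i \<in> carrier (hyperoctahedral n)"
  using assms by (auto simp: hyperoctahedral_def pi_gen_def transpose_def
      intro!: permutes_compose permutes_swap_id)

lemma pi_bar_carrier:
  assumes "1 \<le> n"
  shows "pi_bar n \<in> carrier (hyperoctahedral n)"
  using assms by (auto simp: hyperoctahedral_def pi_bar_def transpose_def
      intro!: permutes_swap_id)

lemma D_gens_subset: "D_gens n \<subseteq> carrier (hyperoctahedral n)"
proof -
  interpret group "hyperoctahedral n" by (rule group_hyperoctahedral)
  have "pi_hat n \<in> carrier (hyperoctahedral n)" if "n \<ge> 2"
    using m_closed[OF m_closed[OF pi_bar_carrier[of n] pi_gen_carrier[of "n - 1" n]]
        pi_bar_carrier[of n]] that
    by (simp add: pi_hat_def hyperoctahedral_def)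
  then show ?thesis
    by (auto simp: D_gens_def intro!: pi_gen_carrier)
qed

lemma D_group_subset: "D_group n \<subseteq> carrier (hyperoctahedral n)"
  unfolding D_group_def
  by (rule group.generate_incl[OF group_hyperoctahedral D_gens_subset])

definition D_length :: "nat \<Rightarrow> (int \<Rightarrow> int) \<Rightarrow> nat" where
  "D_length n \<sigma> = (LEAST k. \<exists>w. length w = k \<and> set w \<subseteq> D_gens n \<and> foldr (\<circ>) w id = \<sigma>)"

text \<open>
  The action of a signed permutation \<open>\<sigma>\<close> on \<open>x\<^sub>1 \<otimes> \<dots> \<otimes> x\<^sub>n\<close>: the factor in position \<open>i\<close> of the
  result is \<open>x\<^sub>k\<close> if \<open>\<sigma>(k) = i\<close> and \<open>J x\<^sub>k\<close> if \<open>\<sigma>(-k) = i\<close> (\<open>k > 0\<close>). The lemmas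
  \<open>signed_act_id\<close>, \<open>signed_act_comp\<close>, \<open>signed_act_pi_gen\<close> and \<open>signed_act_pi_hat\<close> show that
  this is the unique left action with the prescribed action of the generators.
\<close>

definition signed_act :: "('h \<Rightarrow> 'h) \<Rightarrow> (int \<Rightarrow> int) \<Rightarrow> 'h list \<Rightarrow> 'h list" where
  "signed_act J \<sigma> xs =
     map (\<lambda>i. let k = inv_into UNIV \<sigma> (int i + 1) in
                if k > 0 then xs ! (nat k - 1) else J (xs ! (nat (- k) - 1)))
       [0..<length xs]"

lemma length_signed_act [simp]: "length (signed_act J \<sigma> xs) = length xs"
  by (simp add: signed_act_def)

lemma signed_act_nth:
  "i < length xs \<Longrightarrow> signed_act J \<sigma> xs ! i =
    (let k = inv_into UNIV \<sigma> (int i + 1) in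
     if k > 0 then xs ! (nat k - 1) else J (xs ! (nat (- k) - 1)))"
  by (simp add: signed_act_def)

lemma signed_act_id: "signed_act J id xs = xs"
  by (rule nth_equalityI) (simp_all add: signed_act_def nat_add_distrib)

lemma hyperoctahedral_inv_range:
  assumes "\<sigma> \<in> carrier (hyperoctahedral n)" "k \<noteq> 0" "\<bar>k\<bar> \<le> int n"
  shows "inv_into UNIV \<sigma> k \<noteq> 0 \<and> \<bar>inv_into UNIV \<sigma> k\<bar> \<le> int n"
proof -
  have "inv_into UNIV \<sigma> permutes ({- int n..int n} - {0})"
    using assms(1) by (simp add: hyperoctahedral_def permutes_inv)
  from permutes_in_image[OF this, of k] assms(2,3) show ?thesis
    by auto
qed

lemma signed_act_comp:
  assumes "\<sigma> \<in> carrier (hyperoctahedral (length xs))"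
    and "\<tau> \<in> carrier (hyperoctahedral (length xs))"
    and J: "\<And>x. J (J x) = x"
  shows "signed_act J (\<sigma> \<circ> \<tau>) xs = signed_act J \<sigma> (signed_act J \<tau> xs)"
proof (rule nth_equalityI)
  fix i assume "i < length (signed_act J (\<sigma> \<circ> \<tau>) xs)"
  then have i: "i < length xs" by simp
  define k where "k = inv_into UNIV \<sigma> (int i + 1)"
  have k: "k \<noteq> 0" "\<bar>k\<bar> \<le> int (length xs)"
    using hyperoctahedral_inv_range[OF assms(1), of "int i + 1"] i by (auto simp: k_def)
  have l: "inv_into UNIV \<tau> k \<noteq> 0"
    using hyperoctahedral_inv_range[OF assms(2) k] by simp
  have bij: "bij \<sigma>" "bij \<tau>"
    using assms(1,2) by (auto simp: hyperoctahedral_def permutes_bij)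
  have inv: "inv_into UNIV (\<sigma> \<circ> \<tau>) (int i + 1) = inv_into UNIV \<tau> k"
    by (simp add: o_inv_distrib[OF bij] k_def)
  show "signed_act J (\<sigma> \<circ> \<tau>) xs ! i = signed_act J \<sigma> (signed_act J \<tau> xs) ! i"
  proof (cases "k > 0")
    case True
    then have "nat k - 1 < length xs" "int (nat k - 1) + 1 = k"
      using k by auto
    then show ?thesis
      using True i by (simp add: signed_act_def Let_def inv flip: k_def)
  next
    case False
    then have "nat (- k) - 1 < length xs" "int (nat (- k) - 1) + 1 = - k"
      using k by auto
    then show ?thesis
      using False i l J
      by (auto simp: signed_act_def Let_def inv hyperoctahedral_inv_minus[OF assms(2)] simp flip: k_def)
  qed
qed simp

lemma inv_pi_gen: "i \<ge> 1 \<Longrightarrow> inv_into UNIV (pi_gen i) = pi_gen i"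
  by (rule inv_unique_comp) (auto simp: fun_eq_iff pi_gen_apply)

lemma inv_pi_hat: "n \<ge> 2 \<Longrightarrow> inv_into UNIV (pi_hat n) = pi_hat n"
  by (rule inv_unique_comp) (auto simp: fun_eq_iff pi_hat_apply)

lemma signed_act_pi_gen:
  "signed_act J (pi_gen (length xs + 1)) (xs @ [u, v] @ ys) = xs @ [v, u] @ ys"
proof (rule nth_equalityI)
  fix i assume "i < length (signed_act J (pi_gen (length xs + 1)) (xs @ [u, v] @ ys))"
  then have i: "i < length xs + 2 + length ys" by simp
  have nth: "signed_act J (pi_gen (length xs + 1)) (xs @ [u, v] @ ys) ! i =
      (let k = pi_gen (length xs + 1) (int i + 1) in
       if k > 0 then (xs @ [u, v] @ ys) ! (nat k - 1) else J ((xs @ [u, v] @ ys) ! (nat (- k) - 1)))"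
    using i by (subst signed_act_nth) (simp_all add: inv_pi_gen)
  consider "i = length xs" | "i = length xs + 1" | "i < length xs" | "i \<ge> length xs + 2" by linarith
  then show "signed_act J (pi_gen (length xs + 1)) (xs @ [u, v] @ ys) ! i = (xs @ [v, u] @ ys) ! i"
  proof cases
    case 1
    then have "pi_gen (length xs + 1) (int i + 1) = int (length xs + 2)" by (simp add: pi_gen_apply)
    then show ?thesis unfolding nth using 1 by (simp add: nth_append Let_def nat_add_distrib)
  next
    case 2
    then have "pi_gen (length xs + 1) (int i + 1) = int (length xs + 1)" by (simp add: pi_gen_apply)
    then show ?thesis unfolding nth using 2 by (simp add: nth_append Let_def nat_add_distrib)
  next
    case 3
    then have "pi_gen (length xs + 1) (int i + 1) = int (i + 1)" by (simp add: pi_gen_apply)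
    then show ?thesis unfolding nth using 3 by (simp add: nth_append Let_def nat_add_distrib)
  next
    case 4
    then have "pi_gen (length xs + 1) (int i + 1) = int (i + 1)" by (simp add: pi_gen_apply)
    moreover have "\<not> i < length xs" "i - length xs = Suc (Suc (i - length xs - 2))" using 4 by auto
    ultimately show ?thesis unfolding nth by (simp add: nth_append Let_def nat_add_distrib)
  qed
qed simp

lemma signed_act_pi_hat:
  "signed_act J (pi_hat (length xs + 2)) (xs @ [u, v]) = xs @ [J v, J u]"
proof (rule nth_equalityI)
  fix i assume "i < length (signed_act J (pi_hat (length xs + 2)) (xs @ [u, v]))"
  then consider "i = length xs" | "i = Suc (length xs)" | "i < length xs" by fastforce
  then show "signed_act J (pi_hat (length xs + 2)) (xs @ [u, v]) ! i = (xs @ [J v, J u]) ! i"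
    by cases
      (simp_all add: signed_act_def inv_pi_hat pi_hat_apply nth_append nat_add_distrib nth_Cons')
qed simp


section \<open>The deformed Fock space of type D\<close>

text \<open>For \<open>n = 0\<close> and \<open>n = 1\<close> the group \<open>D_group n\<close> is trivial, so \<open>P_hat\<close> is the identity there.\<close>

definition P_hat :: "('h::chilbert_space \<Rightarrow> 'h) \<Rightarrow> real \<Rightarrow> 'h fock \<Rightarrow> 'h fock" where
  "P_hat J q = fock_lift (\<lambda>xs. let n = length xs in
     \<Sum>\<sigma>\<in>D_group n. (complex_of_real q ^ D_length n \<sigma>) *\<^sub>C tens (signed_act J \<sigma> xs))"

lemma multilinear_signed_act:
  assumes "selfadjoint_involution J" and sigma: "\<And>n. \<sigma> n \<in> carrier (hyperoctahedral n)"
  shows "multilinear (\<lambda>xs. tens (signed_act J (\<sigma> (length xs)) xs))"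
proof -
  have J: "J (u + v) = J u + J v" "J (c *\<^sub>C u) = c *\<^sub>C J u" for u v c
    using assms(1) linear_add[OF bounded_linear.linear, of J]
    by (auto simp: selfadjoint_involution_def)
  have *: "\<exists>r<length xs. \<exists>b. \<forall>u. signed_act J \<tau> (xs[i := u]) =
      (signed_act J \<tau> xs)[r := if b then u else J u]"
    if i: "i < length xs" and t: "\<tau> \<in> carrier (hyperoctahedral (length xs))"
    for xs :: "'a list" and i \<tau>
  proof -
    let ?n = "length xs"
    have perm: "\<tau> permutes ({- int ?n..int ?n} - {0})" and odd: "\<tau> (- k) = - \<tau> k" for k
      using t by (auto simp: hyperoctahedral_def)
    define k where "k = \<tau> (int i + 1)"
    have k: "k \<noteq> 0" "\<bar>k\<bar> \<le> int ?n"
      using permutes_in_image[OF perm, of "int i + 1"] i by (auto simp: k_def)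
    have iff: "inv_into UNIV \<tau> (int j + 1) = int i + 1 \<longleftrightarrow> int j + 1 = k"
        "inv_into UNIV \<tau> (int j + 1) = - (int i + 1) \<longleftrightarrow> int j + 1 = - k" for j
      by (auto simp: permutes_inv_eq[OF perm] k_def odd[of "int i + 1"] simp del: minus_add_distrib)
    show ?thesis
    proof (intro exI conjI allI)
      show "nat \<bar>k\<bar> - 1 < length xs"
        using k by auto
      fix u
      show "signed_act J \<tau> (xs[i := u]) =
          (signed_act J \<tau> xs)[nat \<bar>k\<bar> - 1 := if k > 0 then u else J u]"
      proof (rule nth_equalityI)
        fix j assume "j < length (signed_act J \<tau> (xs[i := u]))"
        then have j: "j < ?n" by simp
        define l where "l = inv_into UNIV \<tau> (int j + 1)"
        have l: "l \<noteq> 0" "\<bar>l\<bar> \<le> int ?n"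
          using hyperoctahedral_inv_range[OF t, of "int j + 1"] j by (auto simp: l_def)
        have eq: "l = int i + 1 \<longleftrightarrow> int j + 1 = k" "l = - (int i + 1) \<longleftrightarrow> int j + 1 = - k"
          using iff[of j] by (simp_all add: l_def)
        consider "l = int i + 1" | "l = - (int i + 1)" | "\<bar>l\<bar> \<noteq> int i + 1" by linarith
        then show "signed_act J \<tau> (xs[i := u]) ! j =
          (signed_act J \<tau> xs)[nat \<bar>k\<bar> - 1 := if k > 0 then u else J u] ! j"
        proof cases
          case 1
          then have "k = int j + 1" using eq by simp
          then show ?thesis using j 1 i by (simp add: signed_act_def l_def[symmetric] nat_add_distrib)
        next
          case 2
          then have "k = - (int j + 1)" using eq by simp
          then show ?thesis using j 2 i by (simp add: signed_act_def l_def[symmetric] nat_add_distrib)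
        next
          case 3
          with eq have "int j + 1 \<noteq> k" "int j + 1 \<noteq> - k" by auto
          then have "nat \<bar>k\<bar> - 1 \<noteq> j" using k by linarith
          moreover have "l > 0 \<Longrightarrow> nat l - 1 \<noteq> i" "l < 0 \<Longrightarrow> nat (- l) - 1 \<noteq> i" using 3 by auto
          ultimately show ?thesis
            using j l by (cases "l > 0") (simp_all add: signed_act_def Let_def l_def[symmetric])
        qed
      qed simp
    qed
  qed
  note ml = multilinear_add[OF multilinear_tens] multilinear_scaleC[OF multilinear_tens]
  show ?thesis
    unfolding multilinear_def
  proof (intro conjI allI impI)
    fix xs :: "'a list" and i u v assume "i < length xs"
    from *[OF this sigma] obtain r b where r: "r < length xs"
      and e: "\<And>u. signed_act J (\<sigma> (length xs)) (xs[i := u]) =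
        (signed_act J (\<sigma> (length xs)) xs)[r := if b then u else J u]" by auto
    show "tens (signed_act J (\<sigma> (length (xs[i := u + v]))) (xs[i := u + v])) =
        tens (signed_act J (\<sigma> (length (xs[i := u]))) (xs[i := u])) +
        tens (signed_act J (\<sigma> (length (xs[i := v]))) (xs[i := v]))"
      using r by (cases b) (simp_all add: e J ml)
  next
    fix xs :: "'a list" and i c u assume "i < length xs"
    from *[OF this sigma] obtain r b where r: "r < length xs"
      and e: "\<And>u. signed_act J (\<sigma> (length xs)) (xs[i := u]) =
        (signed_act J (\<sigma> (length xs)) xs)[r := if b then u else J u]" by auto
    show "tens (signed_act J (\<sigma> (length (xs[i := c *\<^sub>C u]))) (xs[i := c *\<^sub>C u])) =
        c *\<^sub>C tens (signed_act J (\<sigma> (length (xs[i := u]))) (xs[i := u]))"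
      using r by (cases b) (simp_all add: e J ml)
  qed
qed

lemma P_hat_tens:
  assumes "selfadjoint_involution J"
  shows "P_hat J q (tens xs) = (\<Sum>\<sigma>\<in>D_group (length xs).
    (complex_of_real q ^ D_length (length xs) \<sigma>) *\<^sub>C tens (signed_act J \<sigma> xs))"
proof -
  have ml: "multilinear (\<lambda>xs. \<Sum>\<sigma>\<in>D_group (length xs).
      (complex_of_real q ^ D_length (length xs) \<sigma>) *\<^sub>C tens (signed_act J \<sigma> xs))"
    (is "multilinear ?\<phi>")
  proof -
    have s: "multilinear (\<lambda>xs. tens (signed_act J (if length xs = n then \<sigma> else id) xs))"
      if "\<sigma> \<in> D_group n" for n \<sigma>
      by (rule multilinear_signed_act[OF assms, of "\<lambda>k. if k = n then \<sigma> else id"])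
        (use that D_group_subset in \<open>auto simp: hyperoctahedral_def\<close>)
    show ?thesis
      unfolding multilinear_def
    proof (intro conjI allI impI)
      fix xs :: "'a list" and i u v assume i: "i < length xs"
      show "?\<phi> (xs[i := u + v]) = ?\<phi> (xs[i := u]) + ?\<phi> (xs[i := v])"
        using multilinear_add[OF s, of _ "length xs" i xs u v] i
        by (simp add: scaleC_add_right flip: sum.distrib)
    next
      fix xs :: "'a list" and i c u assume i: "i < length xs"
      show "?\<phi> (xs[i := c *\<^sub>C u]) = c *\<^sub>C ?\<phi> (xs[i := u])"
        using multilinear_scaleC[OF s, of _ "length xs" i xs c u] i
        by (simp add: complex_vector.scale_sum_right scaleC_scaleC mult.commute)
    qed
  qed
  show ?thesis
    by (simp add: P_hat_def Let_def fock_lift_tens[OF ml])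
qed

definition fock_inner_q ::
    "('h::chilbert_space \<Rightarrow> 'h) \<Rightarrow> real \<Rightarrow> 'h fock \<Rightarrow> 'h fock \<Rightarrow> complex" where
  "fock_inner_q J q f g = fock_inner f (P_hat J q g)"

definition is_adjoint_q ::
    "('h::chilbert_space \<Rightarrow> 'h) \<Rightarrow> real \<Rightarrow> ('h fock \<Rightarrow> 'h fock) \<Rightarrow> ('h fock \<Rightarrow> 'h fock) \<Rightarrow> bool" where
  "is_adjoint_q J q T S \<longleftrightarrow> (\<forall>f g. fock_inner_q J q (T f) g = fock_inner_q J q f (S g))"

text \<open>
  An adjoint of \<open>creation x\<close> is unique (and linear) whenever the \<open>q\<close>-inner product is definite,
  in particular for \<open>-1 < q < 1\<close>; the creation operators themselves do not depend on \<open>q\<close>.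
\<close>

definition annihilation ::
    "('h::chilbert_space \<Rightarrow> 'h) \<Rightarrow> real \<Rightarrow> 'h \<Rightarrow> 'h fock \<Rightarrow> 'h fock" where
  "annihilation J q x = (THE S. is_adjoint_q J q (creation x) S)"

definition gauss_op ::
    "('h::chilbert_space \<Rightarrow> 'h) \<Rightarrow> real \<Rightarrow> 'h \<Rightarrow> 'h fock \<Rightarrow> 'h fock" where
  "gauss_op J q x f = annihilation J q x f + creation x f"


section \<open>Noncrossing pair partitions\<close>

definition pair_partitions :: "nat \<Rightarrow> nat set set set" where
  "pair_partitions n = {P. partition_on {1..n} P \<and> (\<forall>B\<in>P. card B = 2)}"

definition noncrossing :: "nat set set \<Rightarrow> bool" where
  "noncrossing P \<longleftrightarrow>
     \<not> (\<exists>a b c d. {a, b} \<in> P \<and> {c, d} \<in> P \<and> a < c \<and> c < b \<and> b < d)"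

definition NC2 :: "nat \<Rightarrow> nat set set set" where
  "NC2 n = {P \<in> pair_partitions n. noncrossing P}"

end

theory Submission
  imports Defs
begin

text \<open>
  At \<open>q = 0\<close> only the unit of the Coxeter group has length zero, so \<open>P_hat J 0\<close> is the identity
  (\<open>P_hat_0\<close>) and the deformed space is the full Fock space. There the
  adjoint of \<open>creation x\<close> is the free annihilation operator, which contracts \<open>x\<close> with the first
  tensor factor and kills the vacuum. That this operator is \<^emph>\<open>the\<close> adjoint needs the inner product
  on the algebraic tensor powers to be nondegenerate (\<open>fock_inner_nondegenerate\<close>). A given tensor
  involves finitely many vectors only; expanded over an orthogonal system spanning these
  vectors, it has its inner products with elementary tensors as coefficients, up to nonzero factors.

  For the moments, let the operators \<open>G(x k)\<close> act on the vacuum one after the other, starting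
  with the largest index. Creation opens the point \<open>k\<close>; annihilation joins \<open>k\<close> to the first
  tensor factor, which belongs to the smallest open point. Only the smallest open point is ever
  closed, so the pairs that arise do not cross and cover no point that is still open. Conversely
  every noncrossing set of pairs with uncovered open points arises in exactly one way, since the
  status of its smallest point tells the last step (\<open>half_pairings_insert\<close>). Hence the vector
  reached is the sum over these configurations, each with its product of inner products as weight
  and the tensor of its open points (\<open>gauss_product_vacuum\<close>). The inner product with the
  vacuum keeps the configurations without open points, the noncrossing pair partitions.
\<close>

section \<open>Linear maps on the Fock space\<close>

abbreviation clinear :: "('a::complex_vector \<Rightarrow> 'b::complex_vector) \<Rightarrow> bool" where
  "clinear \<equiv> Vector_Spaces.linear scaleC scaleC"

lemma clinearI:
  assumes "\<And>u v. f (u + v) = f u + f v" and "\<And>c u. f (c *\<^sub>C u) = c *\<^sub>C f u"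
  shows "clinear f"
  by (intro Vector_Spaces.linear.intro module_hom.intro module_hom_axioms.intro
      complex_vector.vector_space_axioms complex_vector.module_axioms) (use assms in auto)

lemma clinear_fock_lift: "multilinear \<phi> \<Longrightarrow> clinear (fock_lift \<phi>)"
  by (simp add: clinearI fock_lift_add fock_lift_scaleC)

lemma clinear_fock_inner: "clinear (fock_inner f)"
  by (simp add: clinearI fock_inner_add_right fock_inner_scaleC_right)

lemma clinear_creation: "clinear (creation x)"
  unfolding creation_def by (rule clinear_fock_lift[OF multilinear_creation])

lemma clinear_sum:
  assumes "clinear f"
  shows "f (\<Sum>a\<in>A. r a *\<^sub>C g a) = (\<Sum>a\<in>A. r a *\<^sub>C f (g a))"
proof -
  interpret Vector_Spaces.linear scaleC scaleC f by (rule assms)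
  show ?thesis by (simp add: sum scale)
qed

text \<open>
  The quotient by the relations of multilinearity introduces no vectors beyond the combinations of
  elementary tensors, so a tensor is the combination read off from any representative.
\<close>

lemma free_lift_abs_tens: "free_lift tens f = abs_fock f"
proof (induction f rule: update_induct)
  case const
  then show ?case by (simp add: free_lift_def zero_fock.abs_eq)
next
  case (update f xs c)
  have "Poly_Mapping.update xs c f = c *\<^sub>C Poly_Mapping.single xs (1::complex) + f"
    using update(1) by (intro poly_mapping_eqI)
      (auto simp: lookup_update lookup_add lookup_scaleC lookup_single when_def in_keys_iff)
  with update show ?case
    by (simp add: free_lift_add free_lift_scaleC scaleC_one tens.abs_eq scaleC_fock.abs_eq
        plus_fock.abs_eq)
qed

lemma fock_expansion:
  "t = (\<Sum>xs\<in>Poly_Mapping.keys (rep_fock t). Poly_Mapping.lookup (rep_fock t) xs *\<^sub>C tens xs)"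
  using free_lift_abs_tens[of "rep_fock t"] by (simp add: abs_rep_fock free_lift_def)

lemma fock_lift_unit: "fock_lift tens t = t"
  by (simp add: fock_lift_def free_lift_abs_tens abs_rep_fock)

lemma fock_induct [case_names zero add]:
  assumes "P 0" and "\<And>c xs t. P t \<Longrightarrow> P (c *\<^sub>C tens xs + t)"
  shows "P t"
proof -
  have "P (\<Sum>xs\<in>A. r xs *\<^sub>C tens xs)" if "finite A" for A r
    using that by (induction A) (simp_all add: assms)
  then show ?thesis
    by (subst fock_expansion) simp
qed


section \<open>The deformation is trivial at the parameter zero\<close>

lemma D_gens_involution: "g \<in> D_gens n \<Longrightarrow> g \<circ> g = id"
proof -
  have "pi_gen i \<circ> pi_gen i = id" if "i \<ge> 1" for i
    by (rule ext) (use that in \<open>simp add: pi_gen_apply\<close>)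
  moreover have "pi_hat n \<circ> pi_hat n = id" if "n \<ge> 2" for n
    by (rule ext) (use that in \<open>auto simp: pi_hat_apply\<close>)
  moreover assume "g \<in> D_gens n"
  ultimately show ?thesis by (auto simp: D_gens_def simp del: o_apply split: if_splits)
qed

text \<open>
  The generated subgroup is closed under inverses by definition, whereas \<open>D_length\<close> counts words in
  the generators alone. Since the generators are involutions, inverses add nothing; without such a
  word the minimum in \<open>D_length\<close> would be a minimum over the empty set.
\<close>

lemma D_group_words:
  assumes "\<sigma> \<in> D_group n"
  shows "\<exists>w. set w \<subseteq> D_gens n \<and> foldr (\<circ>) w id = \<sigma>"
  using assms unfolding D_group_def
proof (induction rule: generate.induct)
  case one
  then show ?case by (auto simp: hyperoctahedral_def intro: exI[of _ "[]"])
next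
  case (incl h)
  then show ?case by (auto intro: exI[of _ "[h]"])
next
  case (inv h)
  have "inv\<^bsub>hyperoctahedral n\<^esub> h = h"
    using D_gens_involution[OF inv] D_gens_subset inv
    by (intro group.inv_equality[OF group_hyperoctahedral]) (auto simp: hyperoctahedral_def)
  with inv show ?case by (auto intro: exI[of _ "[h]"])
next
  case (eng h1 h2)
  then obtain w1 w2 where w: "set w1 \<subseteq> D_gens n" "foldr (\<circ>) w1 id = h1"
    "set w2 \<subseteq> D_gens n" "foldr (\<circ>) w2 id = h2" by blast
  have "foldr (\<circ>) (w1 @ w2) id = foldr (\<circ>) w1 id \<circ> foldr (\<circ>) w2 id"
    by (induction w1) (simp_all add: comp_assoc)
  also have "\<dots> = h1 \<otimes>\<^bsub>hyperoctahedral n\<^esub> h2"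
    by (simp only: w(2,4)) (simp add: hyperoctahedral_def)
  finally have "foldr (\<circ>) (w1 @ w2) id = h1 \<otimes>\<^bsub>hyperoctahedral n\<^esub> h2" .
  moreover have "set (w1 @ w2) \<subseteq> D_gens n" using w(1,3) by simp
  ultimately show ?case by (intro exI[of _ "w1 @ w2"] conjI)
qed

lemma D_length_eq_0_iff:
  assumes "\<sigma> \<in> D_group n"
  shows "D_length n \<sigma> = 0 \<longleftrightarrow> \<sigma> = id"
proof
  assume "D_length n \<sigma> = 0"
  moreover have "\<exists>k w. length w = k \<and> set w \<subseteq> D_gens n \<and> foldr (\<circ>) w id = \<sigma>"
    using D_group_words[OF assms] by blast
  then have "\<exists>w. length w = D_length n \<sigma> \<and> set w \<subseteq> D_gens n \<and> foldr (\<circ>) w id = \<sigma>"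
    unfolding D_length_def by (rule LeastI_ex)
  ultimately show "\<sigma> = id" by auto
next
  assume "\<sigma> = id"
  then show "D_length n \<sigma> = 0"
    unfolding D_length_def by (intro Least_eq_0) auto
qed

lemma finite_D_group: "finite (D_group n)"
proof (rule finite_subset)
  show "D_group n \<subseteq> {\<sigma>. \<sigma> permutes ({- int n..int n} - {0})}"
    using D_group_subset[of n] by (auto simp: hyperoctahedral_def)
qed (simp add: finite_permutations)

lemma id_in_D_group: "id \<in> D_group n"
  using generate.one[of "hyperoctahedral n" "D_gens n"]
  by (simp add: D_group_def hyperoctahedral_def)

text \<open>
  As \<open>0 ^ 0 = 1\<close>, the group sum reduces to the term of the unit. Finiteness of the group matters, as
  a sum over an infinite set would vanish by convention.
\<close>

lemma P_hat_0: "P_hat J 0 t = t"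
proof -
  have "(\<Sum>\<sigma>\<in>D_group (length xs). (complex_of_real 0 ^ D_length (length xs) \<sigma>) *\<^sub>C
      tens (signed_act J \<sigma> xs)) = tens xs" for xs
  proof -
    have "(\<Sum>\<sigma>\<in>D_group (length xs). (complex_of_real 0 ^ D_length (length xs) \<sigma>) *\<^sub>C
        tens (signed_act J \<sigma> xs)) =
      (\<Sum>\<sigma>\<in>D_group (length xs). if \<sigma> = id then tens xs else 0)"
      by (rule sum.cong)
        (auto simp: D_length_eq_0_iff id_in_D_group signed_act_id scaleC_one power_0_left)
    also have "\<dots> = tens xs"
      by (simp add: finite_D_group id_in_D_group)
    finally show ?thesis .
  qed
  then show ?thesis
    by (simp add: P_hat_def Let_def fock_lift_unit)
qed

lemma fock_inner_q_0: "fock_inner_q J 0 f g = fock_inner f g"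
  by (simp add: fock_inner_q_def P_hat_0)


section \<open>Nondegeneracy of the undeformed inner product\<close>

text \<open>
  Vectors are not normalised: a nonzero square norm suffices to recover coefficients.
\<close>

definition orthogonal_system :: "'h::chilbert_space set \<Rightarrow> bool" where
  "orthogonal_system E \<longleftrightarrow> 0 \<notin> E \<and> (\<forall>e\<in>E. \<forall>e'\<in>E. e \<noteq> e' \<longrightarrow> cinner e e' = 0)"

lemma clinear_cinner: "clinear (cinner x)"
  by (simp add: clinearI cinner_add_right cinner_scaleC_right)

text \<open>
  The Gram-Schmidt step replaces a new vector by its difference \<open>w\<close> from its projection \<open>p\<close>; if
  \<open>w = 0\<close>, the vector already lies in the span and nothing is added.
\<close>

lemma gram_schmidt:
  assumes "finite V"
  shows "\<exists>E. finite E \<and> orthogonal_system E \<and> V \<subseteq> complex_vector.span E"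
  using assms
proof (induction V)
  case empty
  then show ?case by (auto simp: orthogonal_system_def intro: exI[of _ "{}"])
next
  case (insert v V)
  then obtain E where E: "finite E" "orthogonal_system E" "V \<subseteq> complex_vector.span E"
    by blast
  define p where "p = (\<Sum>e\<in>E. (cinner e v / cinner e e) *\<^sub>C e)"
  define w where "w = v - p"
  have p: "p \<in> complex_vector.span E"
    unfolding p_def
    by (intro complex_vector.span_sum complex_vector.span_scale complex_vector.span_base)
  have ew: "cinner e w = 0" if e: "e \<in> E" for e
  proof -
    have "cinner e p = (\<Sum>e'\<in>E. (cinner e' v / cinner e' e') * cinner e e')"
      unfolding p_def by (subst clinear_sum[OF clinear_cinner]) simp
    also have "\<dots> = (\<Sum>e'\<in>E. if e' = e then cinner e v else 0)"
      using E(2) e by (intro sum.cong) (auto simp: orthogonal_system_def cinner_eq_zero_iff)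
    also have "\<dots> = cinner e v"
      using E(1) e by simp
    finally show ?thesis
      using cinner_add_right[of e w p] by (simp add: w_def)
  qed
  show ?case
  proof (cases "w = 0")
    case True
    then have "v \<in> complex_vector.span E" using p by (simp add: w_def)
    with E show ?thesis by blast
  next
    case False
    have "cinner w e = 0" if "e \<in> E" for e
      using ew[OF that] by (subst cinner_commute) simp
    then have "orthogonal_system (insert w E)"
      using E(2) False ew by (auto simp: orthogonal_system_def)
    moreover have "v \<in> complex_vector.span (insert w E)"
    proof -
      have "w + p \<in> complex_vector.span (insert w E)"
        using p complex_vector.span_mono[of E "insert w E"]
        by (intro complex_vector.span_add) (auto intro: complex_vector.span_base)
      then show ?thesis by (simp add: w_def)
    qed
    moreover have "V \<subseteq> complex_vector.span (insert w E)"
      using E(3) complex_vector.span_mono[of E "insert w E"] by blast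
    ultimately show ?thesis using E(1) by (intro exI[of _ "insert w E"]) simp
  qed
qed

text \<open>
  Multilinear expansion of \<open>ys\<close>, one factor at a time from the left; the prefix \<open>es\<close> collects the
  factors that have already been replaced by elements of \<open>E\<close>.
\<close>

lemma tens_in_span:
  assumes "set es \<subseteq> E" "set ys \<subseteq> complex_vector.span E"
  shows "tens (es @ ys) \<in> complex_vector.span (tens ` lists E)"
  using assms
proof (induction ys arbitrary: es)
  case Nil
  then show ?case by (auto intro: complex_vector.span_base)
next
  case (Cons y ys)
  have add: "tens (es @ (u + v) # ys) = tens (es @ u # ys) + tens (es @ v # ys)" for u v
    using multilinear_add[OF multilinear_tens, of "length es" "es @ u # ys" u v] by simp
  have scale: "tens (es @ (c *\<^sub>C u) # ys) = c *\<^sub>C tens (es @ u # ys)" for c u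
    using multilinear_scaleC[OF multilinear_tens, of "length es" "es @ u # ys" c u] by simp
  have "y \<in> complex_vector.span E" using Cons.prems by simp
  then show ?case
  proof (induction rule: complex_vector.span_induct_alt)
    case base
    show ?case using scale[of 0 0]
      by (simp add: complex_vector.span_zero)
  next
    case (step c e u)
    have "tens ((es @ [e]) @ ys) \<in> complex_vector.span (tens ` lists E)"
      using step(1) Cons.prems by (intro Cons.IH) auto
    then show ?case
      using step(2) by (simp add: add scale complex_vector.span_add complex_vector.span_scale)
  qed
qed

lemma tens_inner_orthogonal:
  assumes "orthogonal_system E" "set xs \<subseteq> E" "set ys \<subseteq> E"
  shows "tens_inner xs ys = 0 \<longleftrightarrow> xs \<noteq> ys"
proof (cases "length xs = length ys")
  case True
  have "cinner (xs ! i) (ys ! i) = 0 \<longleftrightarrow> xs ! i \<noteq> ys ! i" if "i < length xs" for i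
  proof -
    have "xs ! i \<in> E" "ys ! i \<in> E" using that True assms by (auto dest: nth_mem)
    with assms(1) show ?thesis by (auto simp: orthogonal_system_def cinner_eq_zero_iff)
  qed
  with True show ?thesis by (auto simp: tens_inner_def list_eq_iff_nth_eq)
qed (auto simp: tens_inner_def)

text \<open>
  Elementary tensors over an orthogonal system are orthogonal with nonzero square norms, so pairing
  \<open>t\<close> with them isolates its coefficients.
\<close>

lemma fock_inner_nondegenerate:
  assumes "\<And>f. fock_inner f t = 0"
  shows "t = 0"
proof -
  let ?K = "Poly_Mapping.keys (rep_fock t)"
  have "finite (\<Union>xs\<in>?K. set xs)" by simp
  from gram_schmidt[OF this] obtain E where E: "orthogonal_system E"
    "(\<Union>xs\<in>?K. set xs) \<subseteq> complex_vector.span E" by blast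
  have "t \<in> complex_vector.span (tens ` lists E)"
  proof (subst fock_expansion, intro complex_vector.span_sum complex_vector.span_scale)
    fix xs assume "xs \<in> ?K"
    with E(2) have "set xs \<subseteq> complex_vector.span E" by blast
    then show "tens xs \<in> complex_vector.span (tens ` lists E)"
      using tens_in_span[of "[]" E xs] by simp
  qed
  then obtain A r where A: "finite A" "A \<subseteq> tens ` lists E"
    and t: "t = (\<Sum>b\<in>A. r b *\<^sub>C b)"
    unfolding complex_vector.span_explicit by blast
  have "r b = 0" if b: "b \<in> A" for b
  proof -
    have orth: "fock_inner b b' = 0 \<longleftrightarrow> b \<noteq> b'" if b': "b' \<in> A" for b'
    proof -
      obtain es es' where *: "set es \<subseteq> E" "b = tens es" "set es' \<subseteq> E" "b' = tens es'"
        using A(2) b b' unfolding lists_eq_set by blast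
      show ?thesis
      proof (cases "es = es'")
        case True
        then show ?thesis using tens_inner_orthogonal[OF E(1) *(1,3)]
          by (simp add: * fock_inner_tens)
      next
        case False
        then have "fock_inner b b' = 0" and "fock_inner b b \<noteq> 0"
          using tens_inner_orthogonal[OF E(1) *(1,3)] tens_inner_orthogonal[OF E(1) *(1,1)]
          by (simp_all add: * fock_inner_tens)
        then show ?thesis by auto
      qed
    qed
    have "0 = fock_inner b t" by (simp add: assms)
    also have "\<dots> = (\<Sum>b'\<in>A. r b' * fock_inner b b')"
      unfolding t by (subst clinear_sum[OF clinear_fock_inner]) simp
    also have "\<dots> = (\<Sum>b'\<in>A. if b' = b then r b * fock_inner b b else 0)"
      by (rule sum.cong) (auto simp: orth)
    also have "\<dots> = r b * fock_inner b b"
      using A(1) b by simp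
    finally show ?thesis using orth[OF b] by simp
  qed
  then show ?thesis by (simp add: t)
qed


section \<open>The annihilation operators at the parameter zero\<close>

definition contract_head :: "'h::chilbert_space \<Rightarrow> 'h list \<Rightarrow> 'h fock" where
  "contract_head x xs = (case xs of [] \<Rightarrow> 0 | y # ys \<Rightarrow> cinner x y *\<^sub>C tens ys)"

lemma multilinear_contract_head: "multilinear (contract_head x)"
proof -
  note tens = multilinear_add[OF multilinear_tens] multilinear_scaleC[OF multilinear_tens]
  have add: "contract_head x (xs[i := u + v]) = contract_head x (xs[i := u]) + contract_head x (xs[i := v])"
    if "i < length xs" for xs i u v
    using that by (cases xs; cases i)
      (simp_all add: contract_head_def cinner_add_right scaleC_add_left scaleC_add_right tens)
  have scale: "contract_head x (xs[i := c *\<^sub>C u]) = c *\<^sub>C contract_head x (xs[i := u])"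
    if "i < length xs" for xs i c u
    using that by (cases xs; cases i)
      (simp_all add: contract_head_def cinner_scaleC_right scaleC_scaleC tens mult.commute)
  show ?thesis
    using add scale by (simp add: multilinear_def)
qed

definition free_annihilation :: "'h::chilbert_space \<Rightarrow> 'h fock \<Rightarrow> 'h fock" where
  "free_annihilation x = fock_lift (contract_head x)"

lemma free_annihilation_tens:
  "free_annihilation x (tens []) = 0"
  "free_annihilation x (tens (y # ys)) = cinner x y *\<^sub>C tens ys"
  by (simp_all add: free_annihilation_def fock_lift_tens[OF multilinear_contract_head]
      contract_head_def)

lemma clinear_free_annihilation: "clinear (free_annihilation x)"
  unfolding free_annihilation_def by (rule clinear_fock_lift[OF multilinear_contract_head])

lemma tens_inner_Cons: "tens_inner (x # xs) (y # ys) = cinner x y * tens_inner xs ys"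
  by (simp add: tens_inner_def prod.lessThan_Suc_shift del: prod.lessThan_Suc)

lemma fock_inner_zero: "fock_inner f 0 = 0" "fock_inner 0 g = 0"
  using fock_inner_scaleC_right[of f 0 0] fock_inner_scaleC_left[of 0 0 g] by simp_all

text \<open>
  Both sides are sesquilinear, so it suffices to compare them on elementary tensors, where the
  first factor splits off the product of inner products.
\<close>

lemma fock_inner_creation:
  "fock_inner (creation x f) g = fock_inner f (free_annihilation x g)"
proof -
  note lin = Vector_Spaces.linear_iff[THEN iffD1]
  note creation = lin[OF clinear_creation] and ann = lin[OF clinear_free_annihilation]
  have zero: "creation x 0 = 0" "free_annihilation x 0 = 0"
    using creation[of x] ann[of x] by (metis complex_vector.scale_zero_left)+
  have tens: "fock_inner (creation x (tens xs)) (tens ys) =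
      fock_inner (tens xs) (free_annihilation x (tens ys))" for xs ys
    by (cases ys)
      (simp_all add: creation_tens fock_inner_tens free_annihilation_tens tens_inner_Cons
        fock_inner_scaleC_right fock_inner_zero, simp add: tens_inner_def)
  have "fock_inner (creation x (tens xs)) g = fock_inner (tens xs) (free_annihilation x g)" for xs
    by (induction g rule: fock_induct)
      (simp_all add: zero fock_inner_zero ann fock_inner_add_right fock_inner_scaleC_right tens)
  then show ?thesis
    by (induction f rule: fock_induct)
      (simp_all add: zero fock_inner_zero creation fock_inner_add_left fock_inner_scaleC_left)
qed

text \<open>
  The definite description in \<open>annihilation\<close> has a value only because the adjoint is unique, which
  is where nondegeneracy enters.
\<close>

lemma annihilation_0: "annihilation J 0 x = free_annihilation x"
  unfolding annihilation_def
proof (rule the_equality)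
  show "is_adjoint_q J 0 (creation x) (free_annihilation x)"
    by (simp add: is_adjoint_q_def fock_inner_q_0 fock_inner_creation)
next
  fix S assume "is_adjoint_q J 0 (creation x) S"
  then have *: "fock_inner f (S g) = fock_inner f (free_annihilation x g)" for f g
    by (simp add: is_adjoint_q_def fock_inner_q_0 fock_inner_creation)
  have "S g - free_annihilation x g = 0" for g
  proof (rule fock_inner_nondegenerate)
    fix f
    have "S g = (S g - free_annihilation x g) + free_annihilation x g" by simp
    then show "fock_inner f (S g - free_annihilation x g) = 0"
      using *[of f g] fock_inner_add_right[of f "S g - free_annihilation x g" "free_annihilation x g"]
      by simp
  qed
  then show "S = free_annihilation x" by (simp add: fun_eq_iff)
qed

lemma gauss_op_0: "gauss_op J 0 x f = free_annihilation x f + creation x f"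
  by (simp add: gauss_op_def annihilation_0)

lemma clinear_gauss_op_0: "clinear (gauss_op J 0 x)"
proof -
  interpret c: Vector_Spaces.linear scaleC scaleC "creation x"
    by (rule clinear_creation)
  interpret a: Vector_Spaces.linear scaleC scaleC "free_annihilation x"
    by (rule clinear_free_annihilation)
  show ?thesis
    by (rule clinearI)
      (simp_all add: gauss_op_0 c.add a.add c.scale a.scale complex_vector.scale_right_distrib)
qed


section \<open>Noncrossing pairings with open points\<close>

text \<open>
  The configurations \<open>(P, U)\<close> reached when the operators with indices in \<open>A\<close> have acted: \<open>P\<close> holds
  the pairs closed so far and \<open>U\<close> the open points. An open point can be joined only
  to a point smaller than all of \<open>A\<close>, which would cross any pair above it.
\<close>

definition half_pairings :: "nat set \<Rightarrow> (nat set set \<times> nat set) set" where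
  "half_pairings A = {(P, U). U \<subseteq> A \<and> partition_on (A - U) P \<and> (\<forall>B\<in>P. card B = 2) \<and>
     noncrossing P \<and> (\<forall>a b. {a, b} \<in> P \<longrightarrow> (\<forall>u\<in>U. \<not> (a < u \<and> u < b)))}"

lemma half_pairings_empty: "half_pairings {} = {({}, {})}"
  by (auto simp: half_pairings_def partition_on_def noncrossing_def)

lemma finite_half_pairings: "finite A \<Longrightarrow> finite (half_pairings A)"
  by (rule finite_subset[of _ "Pow (Pow A) \<times> Pow A"])
    (auto simp: half_pairings_def partition_on_def)

lemma half_pairings_NC2: "(P, {}) \<in> half_pairings {1..n} \<longleftrightarrow> P \<in> NC2 n"
  by (auto simp: half_pairings_def NC2_def pair_partitions_def)

text \<open>
  Opening the pair of the smallest point \<open>k\<close> turns its partner \<open>b\<close> into an open point. The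
  conditions on \<open>b\<close> as an open point of \<open>P\<close> are those that keep the pair \<open>{k, b}\<close> from crossing \<open>P\<close>,
  and \<open>b\<close> is the smallest open point because \<open>{k, b}\<close> covers none of the others.
\<close>

lemma half_pairings_pair_first:
  assumes k: "\<And>a. a \<in> A \<Longrightarrow> k < a" and b: "b \<in> A" and new: "{k, b} \<notin> P"
  shows "(insert {k, b} P, V) \<in> half_pairings (insert k A) \<longleftrightarrow>
    (P, insert b V) \<in> half_pairings A \<and> (\<forall>v\<in>V. b < v)"
    (is "?L \<longleftrightarrow> ?R")
proof -
  have kA: "k \<notin> A" and kb: "k < b" using k b by blast+
  have part: "partition_on (insert k A - V) (insert {k, b} P) \<longleftrightarrow>
      partition_on (A - insert b V) P \<and> k \<notin> V \<and> b \<notin> V" if "disjnt {k, b} (\<Union>P)"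
  proof -
    have "insert k A - V - {k, b} = A - insert b V" using kA by blast
    then show ?thesis using partition_on_insert[OF that] b by auto
  qed
  show ?thesis
  proof
    assume ?L
    then have V: "V \<subseteq> insert k A" and P: "partition_on (insert k A - V) (insert {k, b} P)"
      and card: "\<And>B. B \<in> P \<Longrightarrow> card B = 2" and nc: "noncrossing (insert {k, b} P)"
      and op: "\<And>a c v. {a, c} \<in> insert {k, b} P \<Longrightarrow> v \<in> V \<Longrightarrow> \<not> (a < v \<and> v < c)"
      unfolding half_pairings_def by blast+
    have "disjnt {k, b} B" if "B \<in> P" for B
      using partition_onD2[OF P] that new unfolding pairwise_def by (metis insertCI)
    then have "disjnt {k, b} (\<Union>P)" by (auto simp: disjnt_def)
    with P part have P': "partition_on (A - insert b V) P" and kV: "k \<notin> V" and bV: "b \<notin> V" by auto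
    have UP: "\<Union>P = A - insert b V" using P' by (simp add: partition_on_def)
    have less: "b < v" if "v \<in> V" for v
    proof -
      have "k < v" "v \<noteq> b" using V kV bV that k by auto
      then show ?thesis using op[of k b v] that by auto
    qed
    have under: "\<not> (a < b \<and> b < c)" if "{a, c} \<in> P" for a c
    proof -
      have "a \<in> A" using UP that by blast
      then have "k < a" using k by blast
      then show ?thesis using nc that unfolding noncrossing_def by blast
    qed
    have nc': "noncrossing P" using nc unfolding noncrossing_def by blast
    have op': "\<not> (a < v \<and> v < c)" if "{a, c} \<in> P" "v \<in> insert b V" for a c v
      using that op[of a c v] under[of a c] by auto
    have "insert b V \<subseteq> A" using V kV b by blast
    then show ?R
      unfolding half_pairings_def mem_Collect_eq prod.case
      using P' card nc' op' less by (intro conjI allI impI ballI) auto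
  next
    assume R: ?R
    then have V: "V \<subseteq> A" and P: "partition_on (A - insert b V) P"
      and card: "\<And>B. B \<in> P \<Longrightarrow> card B = 2" and nc: "noncrossing P"
      and op: "\<And>a c v. {a, c} \<in> P \<Longrightarrow> v \<in> insert b V \<Longrightarrow> \<not> (a < v \<and> v < c)"
      and less: "\<And>v. v \<in> V \<Longrightarrow> b < v"
      unfolding half_pairings_def by blast+
    have UP: "\<Union>P = A - insert b V" using P by (simp add: partition_on_def)
    then have "disjnt {k, b} (\<Union>P)" using kA by (auto simp: disjnt_def)
    then have P': "partition_on (insert k A - V) (insert {k, b} P)"
      using part P V kA less by blast
    have first: "a = k \<and> c = b" if "{a, c} = {k, b}" "a < c" for a c
      using that kb by (auto simp: doubleton_eq_iff)
    have inP: "k < a" if "{a, c} \<in> P" for a c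
      using UP that k by blast
    have nc': "noncrossing (insert {k, b} P)"
      unfolding noncrossing_def
    proof clarify
      fix a c d e
      assume *: "{a, c} \<in> insert {k, b} P" "{d, e} \<in> insert {k, b} P" "a < d" "d < c" "c < e"
      then have "\<not> ({a, c} \<in> P \<and> {d, e} \<in> P)"
        using nc unfolding noncrossing_def by blast
      moreover have "\<not> ({a, c} = {k, b} \<and> {d, e} = {k, b})"
        using first[of a c] first[of d e] * by auto
      moreover have "\<not> ({a, c} \<in> P \<and> {d, e} = {k, b})"
        using first[of d e] inP[of a c] * by auto
      moreover have "\<not> ({a, c} = {k, b} \<and> {d, e} \<in> P)"
        using first[of a c] op[of d e b] * by auto
      ultimately show False using * by blast
    qed
    have op': "\<not> (a < v \<and> v < c)" if "{a, c} \<in> insert {k, b} P" "v \<in> V" for a c v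
      using that first[of a c] less[of v] op[of a c v] by fastforce
    have "card B = 2" if "B \<in> insert {k, b} P" for B
      using that card kb by auto
    then show ?L
      unfolding half_pairings_def mem_Collect_eq prod.case
      using V P' nc' op' by (intro conjI allI impI ballI) auto
  qed
qed

text \<open>The point \<open>k\<close> lies to the left of every pair, hence below none.\<close>

lemma half_pairings_open_first:
  assumes k: "\<And>a. a \<in> A \<Longrightarrow> k < a" and kU: "k \<notin> U"
  shows "(P, insert k U) \<in> half_pairings (insert k A) \<longleftrightarrow> (P, U) \<in> half_pairings A"
proof -
  have kA: "k \<notin> A" using k by blast
  have eq: "insert k A - insert k U = A - U" "insert k U \<subseteq> insert k A \<longleftrightarrow> U \<subseteq> A"
    using kA kU by blast+
  have under: "(\<forall>u\<in>insert k U. \<not> (a < u \<and> u < c)) \<longleftrightarrow> (\<forall>u\<in>U. \<not> (a < u \<and> u < c))"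
    if "partition_on (A - U) P" "{a, c} \<in> P" for a c
  proof -
    have "a \<in> A" using that by (auto simp: partition_on_def)
    then have "k < a" by (rule k)
    then show ?thesis by auto
  qed
  show ?thesis
    unfolding half_pairings_def mem_Collect_eq prod.case eq
    by (intro conj_cong refl iff_allI imp_cong under)
qed

text \<open>
  The smallest point is either open or joined to some \<open>b\<close>. In the second case \<open>b\<close> is the smallest
  open point once this pair is removed, so \<open>b\<close> need not be summed over.
\<close>

lemma half_pairings_insert:
  assumes "finite A" and k: "\<And>a. a \<in> A \<Longrightarrow> k < a"
  shows "half_pairings (insert k A) =
    (\<lambda>(P, U). (P, insert k U)) ` half_pairings A \<union>
    (\<lambda>(P, U). (insert {k, Min U} P, U - {Min U})) ` {(P, U) \<in> half_pairings A. U \<noteq> {}}"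
    (is "_ = ?open \<union> ?pair")
proof (intro equalityI subsetI)
  fix z assume "z \<in> half_pairings (insert k A)"
  then obtain P U where z: "z = (P, U)" and PU: "(P, U) \<in> half_pairings (insert k A)"
    by (cases z) auto
  then have U: "U \<subseteq> insert k A" and P: "partition_on (insert k A - U) P"
    and card: "\<And>B. B \<in> P \<Longrightarrow> card B = 2"
    by (auto simp: half_pairings_def)
  have kA: "k \<notin> A" using k by blast
  show "z \<in> ?open \<union> ?pair"
  proof (cases "k \<in> U")
    case True
    then have U': "U = insert k (U - {k})" by blast
    then have "(P, U - {k}) \<in> half_pairings A"
      using half_pairings_open_first[OF k, where P = P and U = "U - {k}"] PU by auto
    then have "z \<in> ?open"
      using U' by (intro image_eqI[of _ _ "(P, U - {k})"]) (auto simp: z)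
    then show ?thesis ..
  next
    case False
    then have "k \<in> \<Union>P" using P by (auto simp: partition_on_def)
    then obtain B where B: "B \<in> P" "k \<in> B" by blast
    then obtain b where b: "B = {k, b}" "b \<noteq> k"
      using card[OF B(1)] by (auto simp: card_2_iff)
    have kb: "{k, b} \<in> P" using B b by simp
    then have "b \<in> insert k A - U" using P by (auto simp: partition_on_def)
    then have bA: "b \<in> A" "b \<notin> U" using b by auto
    have "insert {k, b} (P - {{k, b}}) = P" using kb by blast
    then have R: "(P - {{k, b}}, insert b U) \<in> half_pairings A" "\<forall>u\<in>U. b < u"
      using half_pairings_pair_first[OF k bA(1), where P = "P - {{k, b}}" and V = U] PU by auto
    have "finite U" using U assms(1) finite_subset by auto
    then have Min: "Min (insert b U) = b"
      using R(2) by (intro Min_eqI) (auto dest: less_imp_le)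
    have "z \<in> ?pair"
      using R(1) kb bA(2) Min
      by (intro image_eqI[of _ _ "(P - {{k, b}}, insert b U)"]) (auto simp: z)
    then show ?thesis ..
  qed
next
  have kA: "k \<notin> A" using k by blast
  fix z assume "z \<in> ?open \<union> ?pair"
  then show "z \<in> half_pairings (insert k A)"
  proof
    assume "z \<in> ?open"
    then obtain P U where z: "z = (P, insert k U)" and PU: "(P, U) \<in> half_pairings A" by auto
    then have "k \<notin> U" using kA by (auto simp: half_pairings_def)
    then show ?thesis
      using half_pairings_open_first[OF k, where P = P and U = U] PU z by simp
  next
    assume "z \<in> ?pair"
    then obtain P U where z: "z = (insert {k, Min U} P, U - {Min U})"
      and PU: "(P, U) \<in> half_pairings A" and "U \<noteq> {}" by auto
    then have U: "U \<subseteq> A" "finite U"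
      using assms(1) by (auto simp: half_pairings_def finite_subset)
    have Min: "Min U \<in> U" using U(2) \<open>U \<noteq> {}\<close> by (rule Min_in)
    have "{k, Min U} \<notin> P"
      using PU kA by (auto simp: half_pairings_def partition_on_def)
    moreover have "\<forall>u\<in>U - {Min U}. Min U < u"
      using U(2) by (auto simp: order.strict_iff_order)
    moreover have "insert (Min U) (U - {Min U}) = U" using Min by blast
    ultimately show ?thesis
      using half_pairings_pair_first[OF k, where b = "Min U" and P = P and V = "U - {Min U}"] U Min PU z by auto
  qed
qed

text \<open>
  The decomposition is unique: whether \<open>k\<close> is open separates the two cases, and in the second one the
  block that contains \<open>k\<close> reveals the open point that was closed.
\<close>

lemma sum_half_pairings_insert:
  fixes f :: "nat set set \<Rightarrow> nat set \<Rightarrow> 'b::comm_monoid_add"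
  assumes A: "finite A" and k: "\<And>a. a \<in> A \<Longrightarrow> k < a"
  shows "(\<Sum>(P, U)\<in>half_pairings (insert k A). f P U) =
    (\<Sum>(P, U)\<in>half_pairings A. f P (insert k U)) +
    (\<Sum>(P, U)\<in>half_pairings A. if U = {} then 0 else f (insert {k, Min U} P) (U - {Min U}))"
proof -
  let ?H = "half_pairings A" and ?H' = "{(P, U) \<in> half_pairings A. U \<noteq> {}}"
  let ?open = "\<lambda>(P, U). (P, insert k U)"
  let ?pair = "\<lambda>(P, U). (insert {k, Min U} P, U - {Min U})"
  have kA: "k \<notin> A" using k by blast
  have sub: "U \<subseteq> A" "finite U" "\<And>B. B \<in> P \<Longrightarrow> B \<subseteq> A" if "(P, U) \<in> ?H" for P U
    using that A by (auto simp: half_pairings_def partition_on_def finite_subset)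
  have Min_in: "Min U \<in> U" if "(P, U) \<in> ?H'" for P U
    using that sub(2)[of P U] by simp
  have kU: "k \<notin> U" if "(P, U) \<in> ?H" for P U
    using sub(1)[OF that] kA by blast
  have "inj_on ?open ?H"
  proof (rule inj_onI, clarify)
    fix P U P' U'
    assume *: "(P, U) \<in> ?H" "(P', U') \<in> ?H" and eq: "insert k U = insert k U'"
    show "P = P \<and> U = U'" using eq kU[OF *(1)] kU[OF *(2)] by (simp add: insert_ident)
  qed
  moreover have "inj_on ?pair ?H'"
  proof (rule inj_onI, clarify)
    fix P U P' U'
    assume *: "(P, U) \<in> ?H" "U \<noteq> {}" "(P', U') \<in> ?H" "U' \<noteq> {}"
      and P: "insert {k, Min U} P = insert {k, Min U'} P'" and U: "U - {Min U} = U' - {Min U'}"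
    have notin: "{k, b} \<notin> P" "{k, b} \<notin> P'" for b
      using sub(3)[OF *(1)] sub(3)[OF *(3)] kA by blast+
    with P have "{k, Min U} = {k, Min U'}" by blast
    then have M: "Min U = Min U'" by (auto simp: doubleton_eq_iff)
    with P notin have "P = P'" by (metis insert_ident)
    moreover have "U = U'"
      using U M insert_Diff[OF Min_in, of P U] insert_Diff[OF Min_in, of P' U'] * by simp
    ultimately show "P = P' \<and> U = U'" ..
  qed
  moreover have "?open ` ?H \<inter> ?pair ` ?H' = {}"
  proof -
    have "k \<notin> U - {Min U}" if "(P, U) \<in> ?H" for P U using kU[OF that] by blast
    then show ?thesis by auto
  qed
  moreover have "finite ?H" "finite ?H'"
    using finite_half_pairings[OF A] by (auto intro: finite_subset[of ?H' ?H])
  ultimately have "(\<Sum>(P, U)\<in>?open ` ?H \<union> ?pair ` ?H'. f P U) =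
      (\<Sum>z\<in>?H. case ?open z of (P, U) \<Rightarrow> f P U) + (\<Sum>z\<in>?H'. case ?pair z of (P, U) \<Rightarrow> f P U)"
    by (simp only: sum.union_disjoint finite_imageI sum.reindex o_def)
  then have "(\<Sum>(P, U)\<in>half_pairings (insert k A). f P U) =
      (\<Sum>(P, U)\<in>?H. f P (insert k U)) + (\<Sum>(P, U)\<in>?H'. f (insert {k, Min U} P) (U - {Min U}))"
    by (simp only: half_pairings_insert[OF A k]) (simp add: case_prod_unfold)
  also have "(\<Sum>(P, U)\<in>?H'. f (insert {k, Min U} P) (U - {Min U})) =
      (\<Sum>(P, U)\<in>?H. if U = {} then 0 else f (insert {k, Min U} P) (U - {Min U}))"
    by (rule sum.mono_neutral_cong_left) (auto intro: finite_half_pairings[OF A] split: if_splits)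
  finally show ?thesis .
qed


section \<open>Moments of the Gaussian operators\<close>

definition pairing_weight :: "(nat \<Rightarrow> 'h::chilbert_space) \<Rightarrow> nat set set \<Rightarrow> complex" where
  "pairing_weight x P = (\<Prod>B\<in>P. cinner (x (Min B)) (x (Max B)))"

lemma pairing_weight_insert:
  assumes "finite P" "{k, b} \<notin> P" "k < b"
  shows "pairing_weight x (insert {k, b} P) = cinner (x k) (x b) * pairing_weight x P"
  using assms by (simp add: pairing_weight_def max_def min_def)

text \<open>
  The tensor factors stand in increasing order of the open points, so the factor contracted by
  annihilation is the one of \<open>Min U\<close>. The induction step is \<open>sum_half_pairings_insert\<close>, with the
  creation part giving the first sum and the annihilation part the second.
\<close>

lemma gauss_product_vacuum:
  fixes x :: "nat \<Rightarrow> 'h::chilbert_space"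
  assumes "sorted_wrt (<) ks"
  shows "foldr (\<lambda>i. gauss_op J 0 (x i)) ks \<Omega> =
    (\<Sum>(P, U)\<in>half_pairings (set ks). pairing_weight x P *\<^sub>C tens (map x (sorted_list_of_set U)))"
  using assms
proof (induction ks)
  case Nil
  show ?case by (simp add: half_pairings_empty pairing_weight_def scaleC_one)
next
  case (Cons k ks)
  let ?A = "set ks"
  let ?t = "\<lambda>U. tens (map x (sorted_list_of_set U))"
  have k: "k < a" if "a \<in> ?A" for a using Cons.prems that by simp
  have step: "pairing_weight x P *\<^sub>C gauss_op J 0 (x k) (?t U) =
      pairing_weight x P *\<^sub>C ?t (insert k U) +
      (if U = {} then 0 else pairing_weight x (insert {k, Min U} P) *\<^sub>C ?t (U - {Min U}))"
    if PU: "(P, U) \<in> half_pairings ?A" for P U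
  proof -
    have U: "U \<subseteq> ?A" "finite U" and P: "finite P" "\<And>B. B \<in> P \<Longrightarrow> B \<subseteq> ?A"
      using PU finite_elements[of "?A - U" P]
      by (auto simp: half_pairings_def partition_on_def finite_subset)
    have "sorted_list_of_set (insert k U) = k # sorted_list_of_set U"
    proof -
      have "Min (insert k U) = k"
        using U k by (intro Min_eqI) (auto dest!: less_imp_le)
      moreover have "insert k U - {k} = U" using U k by auto
      ultimately show ?thesis
        using U sorted_list_of_set_nonempty[of "insert k U"] by simp
    qed
    then have create: "creation (x k) (?t U) = ?t (insert k U)"
      by (simp add: creation_tens)
    show ?thesis
    proof (cases "U = {}")
      case True
      then show ?thesis
        using create by (simp add: gauss_op_0 free_annihilation_tens)
    next
      case False
      then have M: "Min U \<in> ?A" using U Min_in[of U] by blast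
      have "{k, Min U} \<notin> P" using P(2)[of "{k, Min U}"] k by auto
      then have "pairing_weight x (insert {k, Min U} P) =
          cinner (x k) (x (Min U)) * pairing_weight x P"
        using pairing_weight_insert P(1) k M by blast
      moreover have "free_annihilation (x k) (?t U) =
          cinner (x k) (x (Min U)) *\<^sub>C ?t (U - {Min U})"
        using False U(2) by (simp add: sorted_list_of_set_nonempty free_annihilation_tens)
      ultimately show ?thesis
        using False create
        by (simp add: gauss_op_0 scaleC_add_right scaleC_scaleC mult.commute add.commute)
    qed
  qed
  have "foldr (\<lambda>i. gauss_op J 0 (x i)) (k # ks) \<Omega> =
      (\<Sum>(P, U)\<in>half_pairings ?A. pairing_weight x P *\<^sub>C gauss_op J 0 (x k) (?t U))"
    using Cons by (simp add: case_prod_unfold clinear_sum[OF clinear_gauss_op_0])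
  also have "\<dots> = (\<Sum>(P, U)\<in>half_pairings ?A. pairing_weight x P *\<^sub>C ?t (insert k U) +
      (if U = {} then 0 else pairing_weight x (insert {k, Min U} P) *\<^sub>C ?t (U - {Min U})))"
    by (rule sum.cong) (auto simp: step)
  also have "\<dots> = (\<Sum>(P, U)\<in>half_pairings (insert k ?A). pairing_weight x P *\<^sub>C ?t U)"
    by (subst sum_half_pairings_insert) (simp_all add: k case_prod_unfold sum.distrib)
  finally show ?case by simp
qed

theorem corollary4p17:
  fixes J :: "'h::chilbert_space \<Rightarrow> 'h" and x :: "nat \<Rightarrow> 'h" and m :: nat
  assumes "selfadjoint_involution J" and "m \<ge> 1"
  shows "fock_inner_q J 0 \<Omega> (foldr (\<lambda>i. gauss_op J 0 (x i)) [1..<2 * m + 1] \<Omega>) =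
    (\<Sum>P\<in>NC2 (2 * m). \<Prod>B\<in>P. cinner (x (Min B)) (x (Max B)))"
proof -
  let ?H = "half_pairings {1..2 * m}"
  have set: "set [1..<2 * m + 1] = {1..2 * m}" by auto
  have vac: "fock_inner \<Omega> (tens (map x (sorted_list_of_set U))) = (if U = {} then 1 else 0)"
    if "(P, U) \<in> ?H" for P U
  proof -
    have "finite U" using that by (auto simp: half_pairings_def finite_subset)
    then show ?thesis by (auto simp: fock_inner_tens tens_inner_def)
  qed
  have "fock_inner_q J 0 \<Omega> (foldr (\<lambda>i. gauss_op J 0 (x i)) [1..<2 * m + 1] \<Omega>) =
      (\<Sum>(P, U)\<in>?H. pairing_weight x P * fock_inner \<Omega> (tens (map x (sorted_list_of_set U))))"
    by (simp only: fock_inner_q_0 gauss_product_vacuum[OF sorted_wrt_upt] set case_prod_unfold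
        clinear_sum[OF clinear_fock_inner] scaleC_complex_def)
  also have "\<dots> = (\<Sum>(P, U)\<in>?H. if U = {} then pairing_weight x P else 0)"
    by (rule sum.cong) (auto simp: vac)
  also have "\<dots> = (\<Sum>(P, U)\<in>(\<lambda>P. (P, {} :: nat set)) ` NC2 (2 * m). pairing_weight x P)"
    by (rule sum.mono_neutral_cong_right)
      (auto simp: finite_half_pairings half_pairings_NC2[symmetric])
  also have "\<dots> = (\<Sum>P\<in>NC2 (2 * m). pairing_weight x P)"
    by (subst sum.reindex) (auto simp: inj_on_def)
  finally show ?thesis by (simp add: pairing_weight_def)
qed

end
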